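(* Let $K$ be a finite field of characteristic $p$, let $A_1,\ldots,A_s$ be subgroups of the multiplicative group $K^*$, let $B_i=A_i\cup\{0\}$, let $\mathcal{X}=B_1\times\cdots\times B_s\subset K^s$, and let $I\subset S=K[t_1,\ldots,t_s]$ be the vanishing ideal of $\mathcal{X}$. Let $\prec$ be a graded monomial order on $S$. Put $d_i=|A_i|$ and $e_i=|B_i|=d_i+1$, and assume that $\gcd(p,e_i)=p$ for $i=1,\ldots,s$. Let $\mathcal{L}\subset S$ be a linear subspace having a monomial basis $\mathcal{A}=\{t^{a_1},\ldots,t^{a_k}\}\subset\Delta_\prec(I)$, where $t^{a_i}=t_1^{a_{i,1}}\cdots t_s^{a_{i,s}}$, and let $\mathcal{B}=\{t^{b_1},\ldots,t^{b_k}\}$, where $t^{b_i}=\prod_{j=1}^s t_j^{d_j-a_{i,j}}$. The following are equivalent. (a) $\mathcal{A}$ is weakly divisor-closed. (b) $\mathcal{L}^\perp=K(\Delta_\prec(I)\setminus\mathcal{B})$. (c) $(\mathcal{L}_{\mathcal{X}})^\perp$ is a standard monomial code on $\mathcal{X}$.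
   Context: Write $\mathcal{X}=\{P_1,\ldots,P_m\}$. The vanishing ideal $I$ is the ideal of polynomials vanishing on $\mathcal{X}$. $\Delta_\prec(I)$ is the set of standard monomials of $S/I$ (monomials not in $\mathrm{in}_\prec(I)$); here it consists of all $t^c=t_1^{c_1}\cdots t_s^{c_s}$ with $0\le c_i\le d_i$ for all $i$. $K\mathcal{M}$ denotes the $K$-span in $S$ of a set $\mathcal{M}$. For a finite-dimensional linear subspace $\mathcal{L}\subset S$, $\mathcal{L}_{\mathcal{X}}=\{(f(P_1),\ldots,f(P_m)): f\in\mathcal{L}\}\subset K^m$. The algebraic dual is $\mathcal{L}^\perp=\{g\in K\Delta_\prec(I): \varphi(gf)=0\text{ for all }f\in\mathcal{L}\}$, where $\varphi\colon S\to K$ is $\varphi(f)=f(P_1)+\cdots+f(P_m)$. For a code $C\subset K^m$, $C^\perp$ is its dual for the ordinary inner product. For every evaluation code $C=\mathcal{M}_{\mathcal{X}}$ there is a unique linear subspace $\widetilde{\mathcal{M}}\subset K\Delta_\prec(I)$ with $\widetilde{\mathcal{M}}_{\mathcal{X}}=C$, called the standard function space of $C$. The code $C$ is a standard monomial code on $\mathcal{X}$ if its standard function space is spanned by monomials. Weakly divisor-closed: for each $i$ let $D_i=\{t_j: a_{i,j}=d_j\}$. The set $\mathcal{A}$ is weakly divisor-closed if $t^{a_i}/\prod_{t_j\in D}t_j^{a_{i,j}}\in\mathcal{A}$ for all $t^{a_i}\in\mathcal{A}$ and all subsets $D\subset D_i$ (the empty product being $1$). *)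

theory Defs
  imports
    "HOL-Library.Poly_Mapping"
    "HOL-Algebra.Group"
    "HOL-Computational_Algebra.Computational_Algebra"
    "Jordan_Normal_Form.Matrix"
begin

text \<open>
  A monomial \<open>t^c\<close> is represented by its exponent vector \<open>c\<close>, so that products of monomials
  are sums of exponent vectors and division is subtraction. The variables are indexed by a type
  \<open>'s\<close>, which will be finite (and is nonempty, as every type).
\<close>

type_synonym 's expo = "'s \<Rightarrow>\<^sub>0 nat"
type_synonym ('s, 'k) mpol = "('s \<Rightarrow>\<^sub>0 nat) \<Rightarrow>\<^sub>0 'k"

definition tmon :: "'s expo \<Rightarrow> ('s, 'k::comm_ring_1) mpol" where
  "tmon c = Poly_Mapping.single c 1"

definition pscale :: "'k::comm_ring_1 \<Rightarrow> ('s, 'k) mpol \<Rightarrow> ('s, 'k) mpol" where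
  "pscale a f = Poly_Mapping.single 0 a * f"

definition peval :: "('s::finite, 'k::comm_ring_1) mpol \<Rightarrow> ('s \<Rightarrow> 'k) \<Rightarrow> 'k" where
  "peval f x = (\<Sum>c\<in>Poly_Mapping.keys f.
     Poly_Mapping.lookup f c * (\<Prod>j\<in>UNIV. x j ^ Poly_Mapping.lookup c j))"

text \<open>
  The prefix \<open>pvec\<close> refers to the polynomial ring as a vector space over the coefficient field,
  \<open>pideal\<close> to the polynomial ring as a module over itself; thus \<open>pideal.span G\<close> is the ideal
  generated by \<open>G\<close>.
\<close>

global_interpretation pvec: vector_space "pscale :: 'k::field \<Rightarrow> ('s, 'k) mpol \<Rightarrow> ('s, 'k) mpol"
proof
  fix a b :: 'k and f g :: "('s, 'k) mpol"
  show "pscale a (f + g) = pscale a f + pscale a g"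
    by (simp add: pscale_def distrib_left)
  show "pscale (a + b) f = pscale a f + pscale b f"
    by (simp add: pscale_def single_add distrib_right)
  show "pscale a (pscale b f) = pscale (a * b) f"
    by (simp add: pscale_def mult.assoc [symmetric] mult_single)
  show "pscale 1 f = f"
    by (simp add: pscale_def)
qed

global_interpretation pideal:
  Modules.module "(*) :: ('s, 'k::field) mpol \<Rightarrow> ('s, 'k) mpol \<Rightarrow> ('s, 'k) mpol"
  by unfold_locales (simp_all add: algebra_simps)

definition mon_span :: "'s expo set \<Rightarrow> ('s, 'k::field) mpol set" where
  "mon_span M = pvec.span (tmon ` M)"

subsection \<open>Monomial orders and standard monomials\<close>

text \<open>Orders are reflexive relations: \<open>(a, b) \<in> r\<close> means that \<open>t^a\<close> precedes or equals \<open>t^b\<close>.\<close>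

definition monomial_order :: "('s expo \<times> 's expo) set \<Rightarrow> bool" where
  "monomial_order r \<longleftrightarrow>
     well_order_on UNIV r \<and> (\<forall>a b c. (a, b) \<in> r \<longrightarrow> (a + c, b + c) \<in> r)"

definition total_deg :: "'s::finite expo \<Rightarrow> nat" where
  "total_deg c = (\<Sum>j\<in>UNIV. Poly_Mapping.lookup c j)"

definition graded_monomial_order :: "('s::finite expo \<times> 's expo) set \<Rightarrow> bool" where
  "graded_monomial_order r \<longleftrightarrow>
     monomial_order r \<and> (\<forall>a b. total_deg a < total_deg b \<longrightarrow> (a, b) \<in> r)"

definition initial_mon :: "('s expo \<times> 's expo) set \<Rightarrow> ('s, 'k::field) mpol \<Rightarrow> 's expo" where
  "initial_mon r f =
     (THE c. c \<in> Poly_Mapping.keys f \<and> (\<forall>c'\<in>Poly_Mapping.keys f. (c', c) \<in> r))"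

definition initial_ideal ::
    "('s expo \<times> 's expo) set \<Rightarrow> ('s, 'k::field) mpol set \<Rightarrow> ('s, 'k) mpol set" where
  "initial_ideal r I = pideal.span {tmon (initial_mon r f) |f. f \<in> I \<and> f \<noteq> 0}"

definition standard_mons ::
    "('s expo \<times> 's expo) set \<Rightarrow> ('s, 'k::field) mpol set \<Rightarrow> 's expo set" where
  "standard_mons r I = {c. tmon c \<notin> initial_ideal r I}"

definition vanishing_ideal :: "('s::finite \<Rightarrow> 'k::field) set \<Rightarrow> ('s, 'k) mpol set" where
  "vanishing_ideal X = {f. \<forall>x\<in>X. peval f x = 0}"

subsection \<open>Evaluation codes and duals\<close>

text \<open>
  The points \<open>P_1, ..., P_m\<close> are given as a list \<open>Ps\<close>; words of length \<open>m\<close> are elements of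
  \<open>carrier_vec (length Ps)\<close>.
\<close>

definition eval_code ::
    "('s::finite \<Rightarrow> 'k::field) list \<Rightarrow> ('s, 'k) mpol set \<Rightarrow> 'k vec set" where
  "eval_code Ps L = (\<lambda>f. vec (length Ps) (\<lambda>i. peval f (Ps ! i))) ` L"

definition code_dual :: "nat \<Rightarrow> 'k::field vec set \<Rightarrow> 'k vec set" where
  "code_dual m C = {v \<in> carrier_vec m. \<forall>w\<in>C. v \<bullet> w = 0}"

definition eval_sum :: "('s::finite \<Rightarrow> 'k::field) list \<Rightarrow> ('s, 'k) mpol \<Rightarrow> 'k" where
  "eval_sum Ps f = (\<Sum>i<length Ps. peval f (Ps ! i))"

definition alg_dual ::
    "('s::finite expo \<times> 's expo) set \<Rightarrow> ('s \<Rightarrow> 'k::field) list \<Rightarrow>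
     ('s, 'k) mpol set \<Rightarrow> ('s, 'k) mpol set" where
  "alg_dual r Ps L =
     {g \<in> mon_span (standard_mons r (vanishing_ideal (set Ps))).
        \<forall>f\<in>L. eval_sum Ps (g * f) = 0}"

definition is_evaluation_code :: "('s::finite \<Rightarrow> 'k::field) list \<Rightarrow> 'k vec set \<Rightarrow> bool" where
  "is_evaluation_code Ps C \<longleftrightarrow>
     (\<exists>F :: ('s, 'k) mpol set. finite F \<and> C = eval_code Ps (pvec.span F))"

text \<open>Only meaningful for evaluation codes \<open>C\<close>, for which this subspace exists and is unique.\<close>

definition standard_function_space ::
    "('s::finite expo \<times> 's expo) set \<Rightarrow> ('s \<Rightarrow> 'k::field) list \<Rightarrow> 'k vec set \<Rightarrow>
     ('s, 'k) mpol set" where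
  "standard_function_space r Ps C =
     (THE M. pvec.subspace M \<and> M \<subseteq> mon_span (standard_mons r (vanishing_ideal (set Ps))) \<and>
        eval_code Ps M = C)"

definition standard_monomial_code ::
    "('s::finite expo \<times> 's expo) set \<Rightarrow> ('s \<Rightarrow> 'k::field) list \<Rightarrow> 'k vec set \<Rightarrow> bool" where
  "standard_monomial_code r Ps C \<longleftrightarrow>
     is_evaluation_code Ps C \<and> (\<exists>N. standard_function_space r Ps C = mon_span N)"

subsection \<open>Weakly divisor-closed sets of monomials\<close>

definition weakly_divisor_closed :: "('s::finite \<Rightarrow> nat) \<Rightarrow> 's expo set \<Rightarrow> bool" where
  "weakly_divisor_closed d A \<longleftrightarrow>
     (\<forall>a\<in>A. \<forall>D \<subseteq> {j. Poly_Mapping.lookup a j = d j}.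
        a - (\<Sum>j\<in>D. Poly_Mapping.single j (Poly_Mapping.lookup a j)) \<in> A)"

definition complement_mon :: "('s::finite \<Rightarrow> nat) \<Rightarrow> 's expo \<Rightarrow> 's expo" where
  "complement_mon d a = (\<Sum>j\<in>UNIV. Poly_Mapping.single j (d j - Poly_Mapping.lookup a j))"

definition units_group :: "'k::field monoid" where
  "units_group = \<lparr>carrier = UNIV - {0}, mult = (*), one = 1\<rparr>"

end

theory Submission
  imports Defs
begin

text \<open>
  Write \<open>\<phi>(f)\<close> for the sum of the values of \<open>f\<close> over all points. The points form a product, so
  \<open>\<phi>\<close> of a monomial is a product of univariate power sums over the sets \<open>A_j \<union> {0}\<close>. As the
  characteristic divides \<open>d_j + 1\<close>, such a power sum is \<open>-1\<close> if the exponent is a positive multiple of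
  \<open>d_j\<close> and \<open>0\<close> otherwise (\<open>power_sum\<close>). Consequently, for \<open>a\<close> and \<open>b\<close> in the box of
  exponents at most \<open>d_j\<close>, the product of \<open>t^a\<close> with the complement of \<open>t^b\<close> has \<open>\<phi> = \<plusminus>1\<close> if \<open>b\<close>
  arises from \<open>a\<close> by setting to zero some of the coordinates \<open>j\<close> with \<open>a_j = d_j\<close>, that is, if \<open>b\<close> is a
  weak divisor of \<open>a\<close>, and \<open>\<phi> = 0\<close> otherwise (\<open>pairing_complement\<close>). The
  algebraic dual is therefore the solution space of a linear system with one equation for each
  \<open>a \<in> \<A>\<close>: the coefficients at the complements of the weak divisors of \<open>a\<close> sum to zero. If \<open>\<A>\<close> is weakly
  divisor-closed, this system is triangular and says that all coefficients at \<open>\<B>\<close> vanish; if it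
  says only that, then no equation can involve a complement outside \<open>\<B>\<close>, so that \<open>\<A>\<close> is weakly
  divisor-closed (\<open>weakly_divisor_closed_iff_alg_dual\<close>).

  The remaining ingredient is a basis of functions on the points dual to the monomials of the box for
  the pairing \<open>\<phi>(g f)\<close>. It is a product of explicit univariate functions (\<open>dual_fun\<close>), for which
  orthogonality and completeness are both checked directly. Orthogonality extracts coefficients, which
  shows that evaluation is injective on the span of the box and that the box consists of the standard
  monomials (\<open>standard_mons_eq_box\<close>); completeness gives interpolation. Hence the dual code is the
  evaluation of the algebraic dual (\<open>code_dual_eq_eval_alg_dual\<close>), and the algebraic dual is its
  standard function space. So the code condition says that the algebraic dual is spanned by
  some set of monomials, and it remains to see that this set can only be the complement of \<open>\<B>\<close>: no
  monomial in \<open>\<B>\<close> belongs to the dual, while every monomial outside \<open>\<B>\<close> occurs in an element of the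
  dual, namely in the interpolation of a suitable dual function (\<open>monomial_alg_dual_support\<close>).
\<close>

section \<open>Polynomials through their exponent sets and values\<close>

abbreviation mon_val :: "'s::finite expo \<Rightarrow> ('s \<Rightarrow> 'k::comm_ring_1) \<Rightarrow> 'k" where
  "mon_val c x \<equiv> \<Prod>j\<in>UNIV. x j ^ Poly_Mapping.lookup c j"

lemma keys_tmon [simp]: "Poly_Mapping.keys (tmon c :: ('s, 'k::comm_ring_1) mpol) = {c}"
  by (simp add: tmon_def)

lemma tmon_add: "(tmon (a + b) :: ('s, 'k::comm_ring_1) mpol) = tmon a * tmon b"
  by (simp add: tmon_def mult_single)

lemma pscale_tmon: "pscale a (tmon c) = Poly_Mapping.single c a"
  by (simp add: pscale_def tmon_def mult_single)

lemma poly_eq_sum_pscale_tmon: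
  "f = (\<Sum>c\<in>Poly_Mapping.keys f. pscale (Poly_Mapping.lookup f c) (tmon c))"
  unfolding pscale_tmon
  by (rule poly_mapping_eqI) (auto simp: lookup_sum lookup_single when_def in_keys_iff)

lemma keys_pscale: "Poly_Mapping.keys (pscale a f) \<subseteq> Poly_Mapping.keys f"
  unfolding pscale_def using keys_mult [of "Poly_Mapping.single 0 a" f] by (auto split: if_splits)

lemma mon_span_eq_keys_subset:
  "mon_span M = {f :: ('s, 'k::field) mpol. Poly_Mapping.keys f \<subseteq> M}"
proof
  have "pvec.subspace {f :: ('s, 'k) mpol. Poly_Mapping.keys f \<subseteq> M}"
    unfolding pvec.subspace_def
    by (auto dest: subsetD [OF keys_add] subsetD [OF keys_pscale])
  then show "mon_span M \<subseteq> {f :: ('s, 'k) mpol. Poly_Mapping.keys f \<subseteq> M}"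
    unfolding mon_span_def by (rule pvec.span_minimal [rotated]) auto
next
  show "{f :: ('s, 'k) mpol. Poly_Mapping.keys f \<subseteq> M} \<subseteq> mon_span M"
  proof
    fix f :: "('s, 'k) mpol"
    assume "f \<in> {f. Poly_Mapping.keys f \<subseteq> M}"
    then have "(\<Sum>c\<in>Poly_Mapping.keys f. pscale (Poly_Mapping.lookup f c) (tmon c)) \<in> mon_span M"
      unfolding mon_span_def by (intro pvec.span_sum pvec.span_scale pvec.span_base) auto
    then show "f \<in> mon_span M"
      by (simp flip: poly_eq_sum_pscale_tmon)
  qed
qed

lemma subspace_mon_span: "pvec.subspace (mon_span M)"
  by (simp add: mon_span_def)

lemma peval_superset:
  assumes "finite S" and "Poly_Mapping.keys f \<subseteq> S"
  shows "peval f x = (\<Sum>c\<in>S. Poly_Mapping.lookup f c * mon_val c x)"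
  unfolding peval_def using assms by (intro sum.mono_neutral_left) (auto simp: in_keys_iff)

lemma peval_zero [simp]: "peval 0 x = 0"
  by (simp add: peval_def)

lemma peval_tmon [simp]: "peval (tmon c) x = mon_val c x"
  by (simp add: peval_def) (simp add: tmon_def)

lemma peval_add: "peval (f + g) x = peval f x + peval g x"
  using keys_add [of f g]
  by (simp add: peval_superset [of "Poly_Mapping.keys f \<union> Poly_Mapping.keys g"]
      lookup_add distrib_right sum.distrib)

lemma peval_sum: "peval (sum f S) x = (\<Sum>i\<in>S. peval (f i) x)"
  by (induction S rule: infinite_finite_induct) (simp_all add: peval_add)

lemma peval_single: "peval (Poly_Mapping.single c a) x = a * mon_val c x"
  by (simp add: peval_superset [of "{c}"])

lemma mon_val_add: "mon_val (a + b) x = mon_val a x * mon_val b x"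
  by (simp add: lookup_add power_add prod.distrib)

lemma peval_mult: "peval (f * g) x = peval f x * peval g x"
proof -
  let ?F = "Poly_Mapping.keys f" and ?G = "Poly_Mapping.keys g"
  have "f * g = (\<Sum>a\<in>?F. pscale (Poly_Mapping.lookup f a) (tmon a)) *
                (\<Sum>b\<in>?G. pscale (Poly_Mapping.lookup g b) (tmon b))"
    by (simp flip: poly_eq_sum_pscale_tmon)
  also have "peval \<dots> x = (\<Sum>a\<in>?F. \<Sum>b\<in>?G.
      (Poly_Mapping.lookup f a * mon_val a x) * (Poly_Mapping.lookup g b * mon_val b x))"
    by (simp add: sum_product peval_sum pscale_tmon mult_single peval_single mon_val_add mult_ac)
  also have "\<dots> = peval f x * peval g x"
    by (simp add: peval_def sum_product)
  finally show ?thesis .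
qed

lemma peval_pscale: "peval (pscale a f) x = a * peval f x"
  by (simp add: pscale_def peval_mult peval_single)

lemma peval_diff: "peval (f - g) x = peval f x - peval g x"
  using peval_add [of "f - g" g x] by simp

lemma eval_sum_eq_sum_set: "distinct Ps \<Longrightarrow> eval_sum Ps f = (\<Sum>x\<in>set Ps. peval f x)"
  unfolding eval_sum_def
  by (simp add: sum.distinct_set_conv_list sum_list_sum_nth atLeast0LessThan)

section \<open>Power sums over a subgroup together with zero\<close>

text \<open>
  Divisibility of \<open>d + 1\<close>, the number of points of \<open>A \<union> {0}\<close>, by the characteristic enters
  only through the value of \<open>d\<close> in the field.
\<close>

locale subgroup_with_zero =
  fixes A :: "'k::field set" and d :: nat
  assumes finite_A: "finite A"
    and subgroup_A: "subgroup A units_group"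
    and card_A: "card A = d"
    and of_nat_d: "of_nat d = (-1 :: 'k)"
begin

lemma zero_notin_A: "0 \<notin> A" and one_in_A: "1 \<in> A"
  and mult_in_A: "x \<in> A \<Longrightarrow> y \<in> A \<Longrightarrow> x * y \<in> A"
  using subgroup.subset [OF subgroup_A] subgroup.one_closed [OF subgroup_A]
    subgroup.m_closed [OF subgroup_A] by (auto simp: units_group_def)

lemma d_pos: "d > 0"
  using finite_A card_A one_in_A card_gt_0_iff by blast

lemma inj_on_mult_A: "x \<in> A \<Longrightarrow> inj_on ((*) x) A"
  using zero_notin_A by (auto intro!: inj_onI)

lemma mult_image_A:
  assumes "x \<in> A" shows "(*) x ` A = A"
proof (rule card_subset_eq [OF finite_A])
  show "(*) x ` A \<subseteq> A"
    using assms mult_in_A by auto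
  show "card ((*) x ` A) = card A"
    by (rule card_image [OF inj_on_mult_A [OF assms]])
qed

text \<open>Multiplication by \<open>x\<close> permutes \<open>A\<close>; comparing the products of all elements gives \<open>x^d = 1\<close>.\<close>

lemma power_d:
  assumes "x \<in> A" shows "x ^ d = 1"
proof -
  have "\<Prod>A = (\<Prod>y\<in>A. x * y)"
    using prod.reindex [OF inj_on_mult_A [OF assms], of id] mult_image_A [OF assms] by simp
  also have "\<dots> = x ^ d * \<Prod>A"
    by (simp add: prod.distrib card_A)
  finally show ?thesis
    using finite_A zero_notin_A by auto
qed

text \<open>
  The polynomial \<open>t^(c mod d) - 1\<close> has fewer than \<open>d\<close> roots, so some \<open>a\<close> in \<open>A\<close> has \<open>a^c \<noteq> 1\<close>;
  the substitution \<open>x \<mapsto> a x\<close> multiplies the power sum by \<open>a^c\<close> and hence the sum is zero.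
\<close>

lemma power_sum_nondvd:
  assumes "\<not> d dvd c" shows "(\<Sum>x\<in>A. x ^ c) = 0"
proof -
  define m where "m = c mod d"
  have m: "0 < m" "m < d"
    using assms d_pos by (auto simp: m_def dvd_eq_mod_eq_0)
  have pow_m: "x ^ c = x ^ m" if "x \<in> A" for x
  proof -
    have "x ^ c = x ^ (d * (c div d) + m)"
      by (simp add: m_def)
    then show ?thesis
      by (simp add: power_add power_mult power_d [OF that])
  qed
  have "\<exists>a\<in>A. a ^ m \<noteq> 1"
  proof (rule ccontr)
    assume no_such: "\<not> (\<exists>a\<in>A. a ^ m \<noteq> 1)"
    define q where "q = Polynomial.monom (1 :: 'k) m - 1"
    have "poly.coeff q m = 1"
      using m by (simp add: q_def)
    then have "q \<noteq> 0"
      by auto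
    have "A \<subseteq> {x. poly q x = 0}"
      using no_such by (auto simp: q_def poly_monom)
    then have "d \<le> card {x. poly q x = 0}"
      using card_mono [OF poly_roots_finite [OF \<open>q \<noteq> 0\<close>]] card_A by auto
    also have "\<dots> \<le> m"
      by (rule card_poly_roots_bound [OF \<open>q \<noteq> 0\<close>, THEN order_trans])
        (auto simp: q_def intro!: degree_diff_le degree_monom_le)
    finally show False
      using m by simp
  qed
  then obtain a where a: "a \<in> A" "a ^ c \<noteq> 1"
    using pow_m by auto
  have "(\<Sum>x\<in>A. x ^ c) = (\<Sum>x\<in>A. (a * x) ^ c)"
    using sum.reindex [OF inj_on_mult_A [OF a(1)], of "\<lambda>x. x ^ c"] mult_image_A [OF a(1)] by simp
  also have "\<dots> = a ^ c * (\<Sum>x\<in>A. x ^ c)"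
    by (simp add: power_mult_distrib sum_distrib_left)
  finally show ?thesis
    using a(2) by auto
qed

text \<open>
  Over \<open>A\<close> alone the sum would also be \<open>-1\<close> for \<open>c = 0\<close>; the extra point \<open>0\<close> contributes
  \<open>0^0 = 1\<close> and cancels it.
\<close>

lemma power_sum:
  "(\<Sum>x\<in>insert 0 A. x ^ c) = (if c > 0 \<and> d dvd c then -1 else 0)"
proof (cases "d dvd c")
  case True
  then obtain k where "c = d * k" ..
  then have "(\<Sum>x\<in>A. x ^ c) = -1"
    by (simp add: power_mult power_d card_A of_nat_d)
  with True show ?thesis
    using finite_A zero_notin_A by (simp add: power_0_left)
next
  case False
  then show ?thesis
    using finite_A zero_notin_A power_sum_nondvd by (auto simp: power_0_left intro!: Nat.gr0I)
qed

end

text \<open>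
  The exponent at most \<open>d\<close> of the power of \<open>x\<close> that agrees with \<open>x^v\<close> on every subgroup of order
  \<open>d\<close> and at zero; it is the remainder of \<open>t^v\<close> modulo \<open>t^(d+1) - t\<close>.
\<close>

definition fold_expo :: "nat \<Rightarrow> nat \<Rightarrow> nat" where
  "fold_expo d v = (if v = 0 then 0 else (v - 1) mod d + 1)"

lemma fold_expo_le: "fold_expo d v \<le> v"
proof (cases v)
  case (Suc w)
  then show ?thesis
    using mod_less_eq_dividend [of w d] by (simp add: fold_expo_def)
qed (simp add: fold_expo_def)

lemma fold_expo_id: "v \<le> d \<Longrightarrow> fold_expo d v = v"
  by (auto simp: fold_expo_def)

text \<open>
  As functions on a subgroup with zero, these are the basis dual to \<open>1, t, ..., t^d\<close> for the
  pairing that sums products over the points. They come from reading the power sums backwards: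
  \<open>-t^(d-u)\<close> pairs to \<open>1\<close> with \<open>t^u\<close>, and for \<open>u = 0\<close> the constant \<open>1\<close> removes the unwanted pairing
  of \<open>t^d\<close> with itself.
\<close>

definition dual_fun :: "nat \<Rightarrow> nat \<Rightarrow> 'k::comm_ring_1 \<Rightarrow> 'k" where
  "dual_fun d u x = (if u = 0 then 1 - x ^ d else - (x ^ (d - u)))"

context subgroup_with_zero
begin

lemma dual_fun_orthogonal:
  assumes "u \<le> d"
  shows "(\<Sum>x\<in>insert 0 A. x ^ v * dual_fun d u x) = of_bool (fold_expo d v = u)"
proof (cases "u = 0")
  case True
  have "(\<Sum>x\<in>insert 0 A. x ^ v * dual_fun d u x) =
        (\<Sum>x\<in>insert 0 A. x ^ v) - (\<Sum>x\<in>insert 0 A. x ^ (v + d))"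
    unfolding dual_fun_def using True
    by (simp add: right_diff_distrib power_add sum_subtractf del: sum.insert)
  then show ?thesis
    using d_pos True by (auto simp: power_sum fold_expo_def simp del: sum.insert)
next
  case False
  have "(\<Sum>x\<in>insert 0 A. x ^ v * dual_fun d u x) = - (\<Sum>x\<in>insert 0 A. x ^ (v + (d - u)))"
    unfolding dual_fun_def using False
    by (simp add: power_add sum_negf del: sum.insert)
  also have "\<dots> = of_bool (v + (d - u) > 0 \<and> d dvd (v + (d - u)))"
    by (simp add: power_sum del: sum.insert)
  also have "(v + (d - u) > 0 \<and> d dvd (v + (d - u))) \<longleftrightarrow> fold_expo d v = u"
  proof (cases "v = 0")
    case True
    then show ?thesis
      using False assms by (auto simp: fold_expo_def dest: dvd_imp_le)
  next
    case v: False
    have "d dvd (v + (d - u)) \<longleftrightarrow> int d dvd int v - int u"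
    proof -
      have "int (v + (d - u)) = (int v - int u) + int d"
        using assms by simp
      then show ?thesis
        by (metis dvd_add_triv_right_iff int_dvd_int_iff)
    qed
    also have "int v - int u = int (v - 1) - int (u - 1)"
      using v False by simp
    also have "int d dvd \<dots> \<longleftrightarrow> (v - 1) mod d = (u - 1) mod d"
      by (metis mod_eq_dvd_iff of_nat_eq_iff of_nat_mod)
    also have "\<dots> \<longleftrightarrow> fold_expo d v = u"
      using v False assms by (auto simp: fold_expo_def)
    finally show ?thesis
      using v by simp
  qed
  finally show ?thesis .
qed

text \<open>
  The other half of the duality: the kernel reproduces a point. For distinct nonzero \<open>x\<close> and \<open>y\<close>
  this is the factorisation of \<open>x^d - y^d = 0\<close> with the factor \<open>x - y\<close> removed.
\<close>

lemma dual_fun_complete: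
  assumes "x \<in> insert 0 A" and "y \<in> insert 0 A"
  shows "(\<Sum>u\<le>d. dual_fun d u x * y ^ u) = of_bool (x = y)"
proof -
  have "{..d} = insert 0 (Suc ` {..<d})"
    by (auto simp: image_iff) (metis Suc_pred lessThan_iff Suc_le_eq not_gr_zero)
  then have "(\<Sum>u\<le>d. dual_fun d u x * y ^ u) =
      dual_fun d 0 x + (\<Sum>i<d. dual_fun d (Suc i) x * y ^ Suc i)"
    by (simp add: sum.reindex)
  also have "\<dots> = 1 - x ^ d - y * (\<Sum>i<d. x ^ (d - Suc i) * y ^ i)"
    by (simp add: dual_fun_def sum_negf sum_distrib_left mult_ac)
  finally have eq: "(\<Sum>u\<le>d. dual_fun d u x * y ^ u) =
      1 - x ^ d - y * (\<Sum>i<d. x ^ (d - Suc i) * y ^ i)" (is "?K = _ - y * ?S") .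
  have "x ^ d - y ^ d = - (y ^ d - x ^ d)"
    by simp
  also have "\<dots> = - ((y - x) * ?S)"
    by (simp only: power_diff_sumr2)
  also have "\<dots> = (x - y) * ?S"
    by (simp only: minus_mult_left minus_diff_eq)
  finally have geom: "x ^ d - y ^ d = (x - y) * ?S" .
  show ?thesis
  proof (cases "x = y")
    case True
    have "?S = (\<Sum>i<d. x ^ (d - 1))"
      using True by (intro sum.cong) (auto simp flip: power_add)
    then have "y * ?S = - (x * x ^ (d - 1))"
      using True by (simp add: of_nat_d)
    also have "x * x ^ (d - 1) = x ^ d"
      using d_pos by (simp flip: power_Suc)
    finally show ?thesis
      unfolding eq using True by simp
  next
    case neq: False
    show ?thesis
    proof (cases "x = 0")
      case True
      then have "y ^ d = y * ?S"
        using geom d_pos by (simp add: zero_power)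
      moreover have "y ^ d = 1"
        using True neq assms power_d by auto
      ultimately show ?thesis
        unfolding eq using True neq d_pos by (simp add: zero_power)
    next
      case False
      then have "x ^ d = 1" and "y = 0 \<or> y ^ d = 1"
        using assms power_d by auto
      then have "y * ?S = 0"
        using geom neq by auto
      with \<open>x ^ d = 1\<close> show ?thesis
        unfolding eq using neq by simp
    qed
  qed
qed

text \<open>
  One of the two factors is minus a power \<open>x^w\<close>, and the other is the dual function of \<open>w\<close>, so the
  claim is an instance of orthogonality. For \<open>u < d\<close> the power is the second factor and \<open>w = u\<close>; for
  \<open>u = d\<close> it is the first one, the constant \<open>-1\<close>, and \<open>w = 0\<close>.
\<close>

lemma dual_fun_self_pairing:
  assumes "u \<le> d"
  shows "(\<Sum>x\<in>insert 0 A. dual_fun d u x * dual_fun d (d - u) x) = -1"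
proof -
  define w where "w = (if u = d then 0 else u)"
  have w: "w \<le> d" "fold_expo d w = w"
    using assms by (auto simp: w_def fold_expo_id)
  have "dual_fun d u x * dual_fun d (d - u) x = - (x ^ w * dual_fun d w x)" for x :: 'k
    using assms d_pos by (auto simp: dual_fun_def w_def)
  then have "(\<Sum>x\<in>insert 0 A. dual_fun d u x * dual_fun d (d - u) x) =
      - (\<Sum>x\<in>insert 0 A. x ^ w * dual_fun d w x)"
    by (simp only: sum_negf)
  also have "\<dots> = -1"
    using dual_fun_orthogonal [OF w(1), of w] w(2) by simp
  finally show ?thesis .
qed

end

section \<open>Products of such sets: interpolation and coefficient extraction\<close>

lemma prod_of_bool: "finite S \<Longrightarrow> (\<Prod>j\<in>S. of_bool (P j) :: 'a::comm_semiring_1) = of_bool (\<forall>j\<in>S. P j)"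
  by (induction S rule: finite_induct) auto

lemma lookup_complement_mon:
  "Poly_Mapping.lookup (complement_mon d a) j = d j - Poly_Mapping.lookup a j"
  by (simp add: complement_mon_def lookup_sum lookup_single when_def)

locale subgroup_product =
  fixes A :: "'s::finite \<Rightarrow> 'k::field set" and d :: "'s \<Rightarrow> nat"
  assumes factor: "\<And>j. subgroup_with_zero (A j) (d j)"
begin

definition points :: "('s \<Rightarrow> 'k) set" where
  "points = {x. \<forall>j. x j \<in> insert 0 (A j)}"

definition box :: "'s expo set" where
  "box = {c. \<forall>j. Poly_Mapping.lookup c j \<le> d j}"

definition dual_mon :: "'s expo \<Rightarrow> ('s \<Rightarrow> 'k) \<Rightarrow> 'k" where
  "dual_mon c x = (\<Prod>j\<in>UNIV. dual_fun (d j) (Poly_Mapping.lookup c j) (x j))"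

lemma d_pos: "d j > 0"
  using subgroup_with_zero.d_pos [OF factor] .

lemma points_eq_PiE: "points = (\<Pi>\<^sub>E j\<in>UNIV. insert 0 (A j))"
  by (auto simp: points_def)

lemma sum_points_prod:
  "(\<Sum>x\<in>points. \<Prod>j\<in>UNIV. F j (x j)) = (\<Prod>j\<in>UNIV. \<Sum>y\<in>insert 0 (A j). F j y :: 'k)"
  unfolding points_eq_PiE
  by (rule prod_sum_PiE [symmetric]) (auto simp: subgroup_with_zero.finite_A [OF factor])

lemma bij_betw_lookup_box: "bij_betw Poly_Mapping.lookup box (\<Pi>\<^sub>E j\<in>UNIV. {..d j})"
proof (rule bij_betwI [where g = Abs_poly_mapping])
  show "Poly_Mapping.lookup \<in> box \<rightarrow> (\<Pi>\<^sub>E j\<in>UNIV. {..d j})"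
    by (auto simp: box_def)
  show "Abs_poly_mapping \<in> (\<Pi>\<^sub>E j\<in>UNIV. {..d j}) \<rightarrow> box"
    by (auto simp: box_def lookup_Abs_poly_mapping [OF finite] PiE_def Pi_def)
qed (simp_all add: lookup_Abs_poly_mapping [OF finite])

lemma finite_box: "finite box"
  using bij_betw_finite [OF bij_betw_lookup_box] by (simp add: finite_PiE)

lemma sum_box_prod:
  "(\<Sum>c\<in>box. \<Prod>j\<in>UNIV. F j (Poly_Mapping.lookup c j)) = (\<Prod>j\<in>UNIV. \<Sum>u\<le>d j. F j u :: 'k)"
proof -
  have "(\<Prod>j\<in>UNIV. \<Sum>u\<le>d j. F j u) = (\<Sum>u\<in>(\<Pi>\<^sub>E j\<in>UNIV. {..d j}). \<Prod>j\<in>UNIV. F j (u j))"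
    by (rule prod_sum_PiE) auto
  then show ?thesis
    using sum.reindex_bij_betw [OF bij_betw_lookup_box, of "\<lambda>u. \<Prod>j\<in>UNIV. F j (u j)"] by simp
qed

lemma dual_mon_orthogonal:
  assumes "c \<in> box"
  shows "(\<Sum>x\<in>points. mon_val v x * dual_mon c x) =
    of_bool (\<forall>j. fold_expo (d j) (Poly_Mapping.lookup v j) = Poly_Mapping.lookup c j)"
proof -
  have "(\<Sum>x\<in>points. mon_val v x * dual_mon c x) = (\<Prod>j\<in>UNIV. \<Sum>y\<in>insert 0 (A j).
      y ^ Poly_Mapping.lookup v j * dual_fun (d j) (Poly_Mapping.lookup c j) y)"
    unfolding dual_mon_def prod.distrib [symmetric] by (rule sum_points_prod)
  also have "\<dots> = (\<Prod>j\<in>UNIV. of_bool (fold_expo (d j) (Poly_Mapping.lookup v j) = Poly_Mapping.lookup c j))"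
    using assms by (intro prod.cong refl subgroup_with_zero.dual_fun_orthogonal [OF factor])
      (auto simp: box_def)
  finally show ?thesis
    by (simp add: prod_of_bool)
qed

lemma dual_mon_complete:
  assumes "x \<in> points" and "y \<in> points"
  shows "(\<Sum>c\<in>box. dual_mon c x * mon_val c y) = of_bool (x = y)"
proof -
  have "(\<Sum>c\<in>box. dual_mon c x * mon_val c y) =
      (\<Prod>j\<in>UNIV. \<Sum>u\<le>d j. dual_fun (d j) u (x j) * y j ^ u)"
    unfolding dual_mon_def prod.distrib [symmetric]
    by (rule sum_box_prod [of "\<lambda>j u. dual_fun (d j) u (x j) * y j ^ u"])
  also have "\<dots> = (\<Prod>j\<in>UNIV. of_bool (x j = y j))"
    using assms by (intro prod.cong refl subgroup_with_zero.dual_fun_complete [OF factor])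
      (auto simp: points_def)
  finally show ?thesis
    by (simp add: prod_of_bool fun_eq_iff)
qed

lemma dual_mon_self_pairing:
  assumes "c \<in> box"
  shows "(\<Sum>x\<in>points. dual_mon c x * dual_mon (complement_mon d c) x) = (-1) ^ card (UNIV :: 's set)"
proof -
  have "(\<Sum>x\<in>points. dual_mon c x * dual_mon (complement_mon d c) x) =
      (\<Prod>j\<in>UNIV. \<Sum>y\<in>insert 0 (A j). dual_fun (d j) (Poly_Mapping.lookup c j) y *
        dual_fun (d j) (d j - Poly_Mapping.lookup c j) y)"
    unfolding dual_mon_def prod.distrib [symmetric] lookup_complement_mon
    by (rule sum_points_prod)
  also have "\<dots> = (\<Prod>j\<in>(UNIV :: 's set). -1)"
    using assms by (intro prod.cong refl subgroup_with_zero.dual_fun_self_pairing [OF factor])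
      (auto simp: box_def)
  finally show ?thesis
    by simp
qed

text \<open>
  Every monomial of \<open>f\<close> acts on the points like its folded version. Besides extracting coefficients,
  this form serves for unreduced polynomials of the vanishing ideal, where several monomials may fold
  to \<open>c\<close>.
\<close>

lemma pairing_dual_mon:
  assumes "c \<in> box"
  shows "(\<Sum>x\<in>points. peval f x * dual_mon c x) =
    (\<Sum>v\<in>Poly_Mapping.keys f. Poly_Mapping.lookup f v *
      of_bool (\<forall>j. fold_expo (d j) (Poly_Mapping.lookup v j) = Poly_Mapping.lookup c j))"
proof -
  have "(\<Sum>x\<in>points. peval f x * dual_mon c x) =
      (\<Sum>v\<in>Poly_Mapping.keys f. Poly_Mapping.lookup f v * (\<Sum>x\<in>points. mon_val v x * dual_mon c x))"
    unfolding peval_def sum_distrib_left sum_distrib_right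
    by (subst sum.swap) (simp add: mult.assoc)
  then show ?thesis
    by (simp only: dual_mon_orthogonal [OF assms])
qed

lemma coefficient_eq_pairing:
  assumes "c \<in> box" and "Poly_Mapping.keys f \<subseteq> box"
  shows "Poly_Mapping.lookup f c = (\<Sum>x\<in>points. peval f x * dual_mon c x)"
proof -
  have "(\<forall>j. fold_expo (d j) (Poly_Mapping.lookup v j) = Poly_Mapping.lookup c j) \<longleftrightarrow> v = c"
    if "v \<in> Poly_Mapping.keys f" for v
    using that assms(2) by (auto simp: box_def fold_expo_id poly_mapping_eq_iff fun_eq_iff subset_iff)
  then have "(\<Sum>x\<in>points. peval f x * dual_mon c x) =
      (\<Sum>v\<in>Poly_Mapping.keys f. Poly_Mapping.lookup f v * of_bool (v = c))"
    unfolding pairing_dual_mon [OF assms(1)] by (intro sum.cong) auto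
  also have "\<dots> = (\<Sum>v\<in>Poly_Mapping.keys f. if v = c then Poly_Mapping.lookup f v else 0)"
    by (intro sum.cong) auto
  also have "\<dots> = Poly_Mapping.lookup f c"
    by (auto simp: in_keys_iff)
  finally show ?thesis ..
qed

lemma poly_eqI_on_points:
  assumes "Poly_Mapping.keys f \<subseteq> box" and "Poly_Mapping.keys g \<subseteq> box"
    and "\<And>x. x \<in> points \<Longrightarrow> peval f x = peval g x"
  shows "f = g"
proof (rule poly_mapping_eqI)
  fix c
  show "Poly_Mapping.lookup f c = Poly_Mapping.lookup g c"
  proof (cases "c \<in> box")
    case True
    then show ?thesis
      using assms by (simp add: coefficient_eq_pairing)
  next
    case False
    then have "c \<notin> Poly_Mapping.keys f" and "c \<notin> Poly_Mapping.keys g"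
      using assms(1,2) by auto
    then show ?thesis
      by (simp add: in_keys_iff)
  qed
qed

text \<open>
  The coefficient of each monomial of the interpolating polynomial is forced by the extraction
  formula above; completeness of the dual functions confirms the values.
\<close>

lemma interpolation:
  obtains g :: "('s, 'k) mpol"
  where "Poly_Mapping.keys g \<subseteq> box" and "\<And>x. x \<in> points \<Longrightarrow> peval g x = w x"
proof
  define g where "g = (\<Sum>c\<in>box. Poly_Mapping.single c (\<Sum>x\<in>points. w x * dual_mon c x))"
  show "Poly_Mapping.keys g \<subseteq> box"
  proof
    fix c assume "c \<in> Poly_Mapping.keys g"
    then show "c \<in> box"
      by (auto simp: g_def in_keys_iff lookup_sum lookup_single when_def finite_box
          split: if_splits)
  qed
  show "peval g y = w y" if y: "y \<in> points" for y
  proof -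
    have "finite points"
      unfolding points_eq_PiE by (intro finite_PiE) (auto simp: subgroup_with_zero.finite_A [OF factor])
    have "peval g y = (\<Sum>c\<in>box. \<Sum>x\<in>points. w x * (dual_mon c x * mon_val c y))"
      by (simp add: g_def peval_sum peval_single sum_distrib_right mult.assoc)
    also have "\<dots> = (\<Sum>x\<in>points. w x * of_bool (x = y))"
      using y by (subst sum.swap) (simp add: dual_mon_complete flip: sum_distrib_left)
    also have "\<dots> = w y"
      using y \<open>finite points\<close> by (simp add: of_bool_def if_distrib cong: if_cong)
    finally show ?thesis .
  qed
qed

end

section \<open>The standard monomials form a box\<close>

lemma initial_mon_eqI:
  assumes "monomial_order r" and "c \<in> Poly_Mapping.keys f"
    and "\<And>v. v \<in> Poly_Mapping.keys f \<Longrightarrow> (v, c) \<in> r"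
  shows "initial_mon r f = c"
proof -
  have "antisym r"
    using assms(1) by (auto simp: monomial_order_def order_on_defs)
  then show ?thesis
    unfolding initial_mon_def using assms(2,3) by (intro the_equality) (auto dest: antisymD)
qed

lemma initial_mon_greatest:
  assumes "monomial_order r" and "f \<noteq> 0"
  shows "initial_mon r f \<in> Poly_Mapping.keys f"
    and "v \<in> Poly_Mapping.keys f \<Longrightarrow> (v, initial_mon r f) \<in> r"
proof -
  have r: "refl r" "trans r" "total_on UNIV r"
    using assms(1) by (auto simp: monomial_order_def order_on_defs)
  have "\<exists>m\<in>S. \<forall>v\<in>S. (v, m) \<in> r" if "finite S" "S \<noteq> {}" for S
    using that
  proof (induction S rule: finite_ne_induct)
    case (singleton x)
    then show ?case
      using r(1) by (simp add: refl_on_def)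
  next
    case (insert x S)
    then obtain m where m: "m \<in> S" "\<forall>v\<in>S. (v, m) \<in> r"
      by auto
    show ?case
    proof (cases "(x, m) \<in> r")
      case True
      then show ?thesis
        using m by auto
    next
      case False
      moreover from this have "x \<noteq> m"
        using r(1) by (auto simp: refl_on_def)
      ultimately have "(m, x) \<in> r" and "(x, x) \<in> r"
        using r(1,3) by (auto simp: total_on_def refl_on_def)
      then show ?thesis
        using m r(2) by (auto dest: transD)
    qed
  qed
  then obtain m where m: "m \<in> Poly_Mapping.keys f" "\<forall>v\<in>Poly_Mapping.keys f. (v, m) \<in> r"
    using assms(2) by (metis finite_keys keys_eq_empty)
  then have "initial_mon r f = m"
    using assms(1) by (intro initial_mon_eqI) auto
  then show "initial_mon r f \<in> Poly_Mapping.keys f"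
    and "v \<in> Poly_Mapping.keys f \<Longrightarrow> (v, initial_mon r f) \<in> r"
    using m by auto
qed

text \<open>
  The polynomials all of whose monomials are divisible by one of the generators form an ideal, so
  membership of a monomial in a monomial ideal is divisibility by a generator.
\<close>

lemma tmon_in_initial_ideal_iff:
  "tmon c \<in> initial_ideal r (I :: ('s, 'k::field) mpol set) \<longleftrightarrow>
    (\<exists>f\<in>I. f \<noteq> 0 \<and> (\<exists>w. c = w + initial_mon r f))"
proof
  let ?G = "{tmon (initial_mon r f) :: ('s, 'k) mpol |f. f \<in> I \<and> f \<noteq> 0}"
  define M where "M = {c. \<exists>f\<in>I. f \<noteq> 0 \<and> (\<exists>w. c = w + initial_mon r f)}"
  have M_add: "w + v \<in> M" if "v \<in> M" for w v
    using that unfolding M_def by (auto simp flip: add.assoc)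
  have "pideal.subspace {f :: ('s, 'k) mpol. Poly_Mapping.keys f \<subseteq> M}"
    unfolding pideal.subspace_def
    by (auto dest!: subsetD [OF keys_add] subsetD [OF keys_mult] intro!: M_add)
  moreover have "?G \<subseteq> {f. Poly_Mapping.keys f \<subseteq> M}"
    unfolding M_def by (auto intro: exI [of _ 0])
  ultimately have "initial_ideal r I \<subseteq> {f. Poly_Mapping.keys f \<subseteq> M}"
    unfolding initial_ideal_def by (intro pideal.span_minimal)
  then show "\<exists>f\<in>I. f \<noteq> 0 \<and> (\<exists>w. c = w + initial_mon r f)" if "tmon c \<in> initial_ideal r I"
    using that by (auto simp: M_def)
  assume "\<exists>f\<in>I. f \<noteq> 0 \<and> (\<exists>w. c = w + initial_mon r f)"
  then obtain f w where f: "f \<in> I" "f \<noteq> 0" and c: "c = w + initial_mon r f"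
    by auto
  have "tmon w * tmon (initial_mon r f) \<in> initial_ideal r I"
    unfolding initial_ideal_def using f by (intro pideal.span_scale pideal.span_base) blast
  then show "tmon c \<in> initial_ideal r I"
    by (simp add: c tmon_add)
qed

context subgroup_product
begin

text \<open>
  Outside the box, \<open>t_j^(d_j + 1) - t_j\<close> vanishes on the points and its initial monomial divides
  the given one. Inside the box, a nonzero \<open>f\<close> in the ideal with initial monomial \<open>u\<close> dividing it
  would pair to zero with the dual function of \<open>u\<close>. That pairing collects the coefficients of all
  monomials folding to \<open>u\<close>; every one of them except \<open>u\<close> has larger degree than \<open>u\<close>, hence does
  not occur in \<open>f\<close>, so the pairing is the nonzero leading coefficient.
\<close>

lemma standard_mons_eq_box:
  assumes "graded_monomial_order r"
  shows "standard_mons r (vanishing_ideal points) = box"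
proof -
  have mo: "monomial_order r"
    and graded: "\<And>a b. total_deg a < total_deg b \<Longrightarrow> (a, b) \<in> r"
    using assms by (auto simp: graded_monomial_order_def)
  then have refl: "refl r" and antisym: "antisym r"
    by (auto simp: monomial_order_def order_on_defs)
  have "tmon c \<in> initial_ideal r (vanishing_ideal points)" if c: "c \<notin> box" for c
  proof -
    obtain j where j: "Poly_Mapping.lookup c j > d j"
      using c by (auto simp: box_def not_le)
    define hi lo where "hi = Poly_Mapping.single j (Suc (d j))" and "lo = Poly_Mapping.single j (1 :: nat)"
    define f :: "('s, 'k) mpol" where "f = tmon hi - tmon lo"
    have val: "mon_val (Poly_Mapping.single j n) x = x j ^ n" for n and x :: "'s \<Rightarrow> 'k"
    proof -
      have "mon_val (Poly_Mapping.single j n) x = (\<Prod>i\<in>UNIV. if i = j then x i ^ n else 1)"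
        by (intro prod.cong) (auto simp: lookup_single when_def)
      then show ?thesis
        by simp
    qed
    have "peval f x = 0" if "x \<in> points" for x
    proof (cases "x j = 0")
      case False
      then have "x j ^ d j = 1"
        using that subgroup_with_zero.power_d [OF factor] by (auto simp: points_def)
      then show ?thesis
        by (simp add: f_def peval_diff hi_def lo_def val)
    qed (simp add: f_def peval_diff hi_def lo_def val)
    then have f_in: "f \<in> vanishing_ideal points"
      by (simp add: vanishing_ideal_def)
    have "hi \<noteq> lo"
      using d_pos [of j] by (auto simp: hi_def lo_def dest: arg_cong [where f = "\<lambda>c. Poly_Mapping.lookup c j"])
    then have hi: "hi \<in> Poly_Mapping.keys f"
      by (simp add: f_def in_keys_iff lookup_minus tmon_def lookup_single)
    have deg: "total_deg (Poly_Mapping.single j n) = n" for n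
      by (simp add: total_deg_def lookup_single when_def)
    have "(lo, hi) \<in> r"
      using d_pos [of j] by (intro graded) (simp add: hi_def lo_def deg)
    moreover have "Poly_Mapping.keys f \<subseteq> {hi, lo}"
      using keys_diff [of "tmon hi :: ('s, 'k) mpol" "tmon lo"] by (auto simp: f_def)
    ultimately have "initial_mon r f = hi"
      using mo hi refl by (intro initial_mon_eqI) (auto simp: refl_on_def)
    moreover have "c = (c - hi) + hi"
      using j by (intro poly_mapping_eqI) (auto simp: hi_def lookup_add lookup_minus lookup_single when_def)
    moreover have "f \<noteq> 0"
      using hi by auto
    ultimately show ?thesis
      using f_in unfolding tmon_in_initial_ideal_iff by metis
  qed
  moreover have "tmon c \<notin> initial_ideal r (vanishing_ideal points)" if c: "c \<in> box" for c
  proof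
    assume "tmon c \<in> initial_ideal r (vanishing_ideal points)"
    then obtain f w where f: "f \<in> vanishing_ideal points" "f \<noteq> 0" and w: "c = w + initial_mon r f"
      unfolding tmon_in_initial_ideal_iff by auto
    define u where "u = initial_mon r f"
    have "u \<in> box"
      using c by (auto simp: box_def w u_def lookup_add intro: add_leD2)
    have u: "u \<in> Poly_Mapping.keys f" "\<And>v. v \<in> Poly_Mapping.keys f \<Longrightarrow> (v, u) \<in> r"
      using initial_mon_greatest [OF mo f(2)] by (auto simp: u_def)
    have only_u: "(\<forall>j. fold_expo (d j) (Poly_Mapping.lookup v j) = Poly_Mapping.lookup u j) \<longleftrightarrow> v = u"
      if v: "v \<in> Poly_Mapping.keys f" for v
    proof
      assume fold: "\<forall>j. fold_expo (d j) (Poly_Mapping.lookup v j) = Poly_Mapping.lookup u j"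
      have le: "Poly_Mapping.lookup u j \<le> Poly_Mapping.lookup v j" for j
        using fold fold_expo_le by metis
      show "v = u"
      proof (rule ccontr)
        assume "v \<noteq> u"
        then obtain j where "Poly_Mapping.lookup v j \<noteq> Poly_Mapping.lookup u j"
          by (auto simp: poly_mapping_eq_iff fun_eq_iff)
        then have "Poly_Mapping.lookup u j < Poly_Mapping.lookup v j"
          using le [of j] by simp
        then have "total_deg u < total_deg v"
          unfolding total_deg_def using le by (intro sum_strict_mono_ex1) auto
        then have "(u, v) \<in> r"
          by (rule graded)
        then show False
          using u(2) [OF v] antisym \<open>v \<noteq> u\<close> by (auto dest: antisymD)
      qed
    next
      assume "v = u"
      then show "\<forall>j. fold_expo (d j) (Poly_Mapping.lookup v j) = Poly_Mapping.lookup u j"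
        using \<open>u \<in> box\<close> by (simp add: box_def fold_expo_id)
    qed
    have "0 = (\<Sum>x\<in>points. peval f x * dual_mon u x)"
      using f(1) by (simp add: vanishing_ideal_def)
    also have "\<dots> = (\<Sum>v\<in>Poly_Mapping.keys f. if v = u then Poly_Mapping.lookup f v else 0)"
      unfolding pairing_dual_mon [OF \<open>u \<in> box\<close>] by (intro sum.cong) (auto simp: only_u)
    also have "\<dots> = Poly_Mapping.lookup f u"
      using u(1) by simp
    finally show False
      using u(1) by (simp add: in_keys_iff)
  qed
  ultimately show ?thesis
    by (auto simp: standard_mons_def)
qed

end

section \<open>Weak divisors and the algebraic dual\<close>

definition weak_divisor :: "('s::finite \<Rightarrow> nat) \<Rightarrow> 's expo \<Rightarrow> 's expo \<Rightarrow> bool" where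
  "weak_divisor d b a \<longleftrightarrow> (\<forall>j. Poly_Mapping.lookup b j = Poly_Mapping.lookup a j \<or>
     Poly_Mapping.lookup b j = 0 \<and> Poly_Mapping.lookup a j = d j)"

lemma weak_divisor_refl: "weak_divisor d a a"
  by (simp add: weak_divisor_def)

lemma weak_divisor_le: "weak_divisor d b a \<Longrightarrow> Poly_Mapping.lookup b j \<le> Poly_Mapping.lookup a j"
  unfolding weak_divisor_def by (metis le0 order_refl)

lemma total_deg_weak_divisor_less:
  assumes "weak_divisor d b a" and "b \<noteq> a"
  shows "total_deg b < total_deg a"
proof -
  obtain j where "Poly_Mapping.lookup b j \<noteq> Poly_Mapping.lookup a j"
    using assms(2) by (auto simp: poly_mapping_eq_iff fun_eq_iff)
  then have "Poly_Mapping.lookup b j < Poly_Mapping.lookup a j"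
    using weak_divisor_le [OF assms(1), of j] by simp
  then show ?thesis
    unfolding total_deg_def using weak_divisor_le [OF assms(1)] by (intro sum_strict_mono_ex1) auto
qed

text \<open>
  Describing the divisors coordinate by coordinate matches the product form of the pairing sums,
  which also decide each variable separately.
\<close>

lemma weakly_divisor_closed_iff:
  fixes d :: "'s::finite \<Rightarrow> nat"
  shows "weakly_divisor_closed d S \<longleftrightarrow> (\<forall>a\<in>S. \<forall>b. weak_divisor d b a \<longrightarrow> b \<in> S)"
proof -
  define strip where "strip = (\<lambda>(a :: 's expo) D.
    a - (\<Sum>j\<in>D. Poly_Mapping.single j (Poly_Mapping.lookup a j)))"
  have lookup_strip: "Poly_Mapping.lookup (strip a D) j = (if j \<in> D then 0 else Poly_Mapping.lookup a j)" for a D j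
    by (simp add: strip_def lookup_minus lookup_sum lookup_single when_def)
  have strip_wd: "weak_divisor d (strip a D) a" if "D \<subseteq> {j. Poly_Mapping.lookup a j = d j}" for a D
    using that by (auto simp: weak_divisor_def lookup_strip)
  have wd_strip: "\<exists>D\<subseteq>{j. Poly_Mapping.lookup a j = d j}. b = strip a D" if "weak_divisor d b a" for a b
  proof (intro exI conjI)
    let ?D = "{j. Poly_Mapping.lookup a j = d j \<and> Poly_Mapping.lookup b j = 0}"
    show "?D \<subseteq> {j. Poly_Mapping.lookup a j = d j}"
      by auto
    show "b = strip a ?D"
      using that by (intro poly_mapping_eqI) (auto simp: weak_divisor_def lookup_strip)
  qed
  have closed: "weakly_divisor_closed d S \<longleftrightarrow>
      (\<forall>a\<in>S. \<forall>D\<subseteq>{j. Poly_Mapping.lookup a j = d j}. strip a D \<in> S)"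
    by (simp add: weakly_divisor_closed_def strip_def)
  show ?thesis
    unfolding closed
  proof (intro iffI ballI allI impI)
    fix a b
    assume "\<forall>a\<in>S. \<forall>D\<subseteq>{j. Poly_Mapping.lookup a j = d j}. strip a D \<in> S" "a \<in> S" "weak_divisor d b a"
    then show "b \<in> S"
      using wd_strip [of b a] by auto
  qed (use strip_wd in auto)
qed

context subgroup_product
begin

lemma complement_in_box: "complement_mon d c \<in> box"
  by (simp add: box_def lookup_complement_mon)

lemma complement_complement: "c \<in> box \<Longrightarrow> complement_mon d (complement_mon d c) = c"
  by (intro poly_mapping_eqI) (simp add: box_def lookup_complement_mon)

lemma weak_divisor_in_box: "a \<in> box \<Longrightarrow> weak_divisor d b a \<Longrightarrow> b \<in> box"
  unfolding box_def using weak_divisor_le le_trans by blast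

text \<open>
  In each variable the exponent \<open>a_j + d_j - b_j\<close> is at most \<open>2 d_j\<close>. Its power sum is nonzero only
  at \<open>d_j\<close>, where \<open>b_j = a_j\<close>, and at \<open>2 d_j\<close>, where \<open>a_j = d_j\<close> and \<open>b_j = 0\<close>.
\<close>

lemma pairing_complement:
  assumes "a \<in> box" and "b \<in> box"
  shows "(\<Sum>x\<in>points. mon_val (complement_mon d b) x * mon_val a x) =
    (if weak_divisor d b a then (-1) ^ card (UNIV :: 's set) else 0)"
proof -
  define P where "P j \<longleftrightarrow> Poly_Mapping.lookup b j = Poly_Mapping.lookup a j \<or>
     Poly_Mapping.lookup b j = 0 \<and> Poly_Mapping.lookup a j = d j" for j
  have factor_sum: "(\<Sum>y\<in>insert 0 (A j). y ^ (d j - Poly_Mapping.lookup b j + Poly_Mapping.lookup a j)) =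
      - of_bool (P j)" for j
  proof -
    let ?n = "d j - Poly_Mapping.lookup b j + Poly_Mapping.lookup a j"
    have le: "Poly_Mapping.lookup a j \<le> d j" "Poly_Mapping.lookup b j \<le> d j"
      using assms by (auto simp: box_def)
    have "?n > 0 \<and> d j dvd ?n \<longleftrightarrow> ?n = d j \<or> ?n = 2 * d j"
    proof
      assume n: "?n > 0 \<and> d j dvd ?n"
      then obtain k where k: "?n = d j * k"
        by (elim conjE dvdE)
      have "d j * k \<le> d j * 2"
        using le k by linarith
      then have "k \<le> 2" and "k \<noteq> 0"
        using d_pos [of j] n unfolding k by auto
      then have "k = 1 \<or> k = 2"
        by linarith
      then show "?n = d j \<or> ?n = 2 * d j"
        unfolding k by auto
    qed (use d_pos [of j] in auto)
    also have "\<dots> \<longleftrightarrow> P j"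
      using le unfolding P_def by linarith
    finally show ?thesis
      unfolding subgroup_with_zero.power_sum [OF factor] by simp
  qed
  have "(\<Sum>x\<in>points. mon_val (complement_mon d b) x * mon_val a x) =
      (\<Prod>j\<in>UNIV. \<Sum>y\<in>insert 0 (A j). y ^ (d j - Poly_Mapping.lookup b j + Poly_Mapping.lookup a j))"
    unfolding prod.distrib [symmetric] power_add [symmetric] lookup_complement_mon
    by (rule sum_points_prod)
  also have "\<dots> = (\<Prod>j\<in>UNIV. - of_bool (P j))"
    by (simp only: factor_sum)
  also have "\<dots> = (\<Prod>j\<in>(UNIV :: 's set). -1) * (\<Prod>j\<in>UNIV. of_bool (P j))"
    unfolding prod.distrib [symmetric] by simp
  also have "\<dots> = (if weak_divisor d b a then (-1) ^ card (UNIV :: 's set) else 0)"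
    by (simp add: prod_of_bool weak_divisor_def P_def)
  finally show ?thesis .
qed

text \<open>
  Complementation is an involution of the box, so \<open>g\<close> can be expanded in complementary monomials.
\<close>

lemma pairing_poly_mon:
  assumes "Poly_Mapping.keys g \<subseteq> box" and "a \<in> box"
  shows "(\<Sum>x\<in>points. peval g x * mon_val a x) = (-1) ^ card (UNIV :: 's set) *
    (\<Sum>b | weak_divisor d b a. Poly_Mapping.lookup g (complement_mon d b))"
proof -
  have "bij_betw (complement_mon d) box box"
    by (rule bij_betwI [where g = "complement_mon d"])
      (simp_all add: complement_in_box complement_complement)
  then have "peval g x = (\<Sum>b\<in>box. Poly_Mapping.lookup g (complement_mon d b) *
      mon_val (complement_mon d b) x)" for x
    unfolding peval_superset [OF finite_box assms(1)] by (rule sum.reindex_bij_betw [symmetric])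
  then have "(\<Sum>x\<in>points. peval g x * mon_val a x) = (\<Sum>b\<in>box. Poly_Mapping.lookup g (complement_mon d b) *
      (\<Sum>x\<in>points. mon_val (complement_mon d b) x * mon_val a x))"
    unfolding sum_distrib_left by (subst sum.swap) (simp add: sum_distrib_right mult.assoc)
  also have "\<dots> = (\<Sum>b\<in>box. if weak_divisor d b a
      then (-1) ^ card (UNIV :: 's set) * Poly_Mapping.lookup g (complement_mon d b) else 0)"
    by (intro sum.cong) (simp_all add: pairing_complement [OF assms(2)])
  also have "\<dots> = (\<Sum>b | b \<in> box \<and> weak_divisor d b a.
      (-1) ^ card (UNIV :: 's set) * Poly_Mapping.lookup g (complement_mon d b))"
    using finite_box by (rule sum.inter_filter [symmetric])
  also have "{b. b \<in> box \<and> weak_divisor d b a} = {b. weak_divisor d b a}"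
    using weak_divisor_in_box [OF assms(2)] by auto
  finally show ?thesis
    by (simp add: sum_distrib_left)
qed

end

locale evaluation_points = subgroup_product A d
  for A :: "'s::finite \<Rightarrow> 'k::field set" and d :: "'s \<Rightarrow> nat" +
  fixes Ps :: "('s \<Rightarrow> 'k) list" and r :: "('s expo \<times> 's expo) set"
  assumes distinct_Ps: "distinct Ps" and set_Ps: "set Ps = points"
    and graded: "graded_monomial_order r"
begin

abbreviation standard_space :: "('s, 'k) mpol set" where
  "standard_space \<equiv> mon_span (standard_mons r (vanishing_ideal (set Ps)))"

lemma standard_space_eq: "standard_space = {f. Poly_Mapping.keys f \<subseteq> box}"
  by (simp add: set_Ps standard_mons_eq_box [OF graded] mon_span_eq_keys_subset)

lemma eval_sum_mult: "eval_sum Ps (g * f) = (\<Sum>x\<in>points. peval g x * peval f x)"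
  by (simp add: eval_sum_eq_sum_set distinct_Ps set_Ps peval_mult)

text \<open>
  Orthogonality to a span of monomials is tested on the monomials, which turns the dual into the
  solution space of one linear equation for each element of \<open>S\<close>.
\<close>

lemma alg_dual_mon_span:
  "alg_dual r Ps (mon_span S) = {g. Poly_Mapping.keys g \<subseteq> box \<and>
     (\<forall>a\<in>S. (\<Sum>x\<in>points. peval g x * mon_val a x) = 0)}" (is "_ = ?R")
proof
  show "alg_dual r Ps (mon_span S) \<subseteq> ?R"
  proof
    fix g assume g: "g \<in> alg_dual r Ps (mon_span S)"
    have "(\<Sum>x\<in>points. peval g x * mon_val a x) = 0" if "a \<in> S" for a
    proof -
      have "(tmon a :: ('s, 'k) mpol) \<in> mon_span S"
        using that by (simp add: mon_span_eq_keys_subset)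
      then have "eval_sum Ps (g * tmon a) = 0"
        using g by (simp add: alg_dual_def)
      then show ?thesis
        by (simp add: eval_sum_mult)
    qed
    then show "g \<in> ?R"
      using g by (auto simp: alg_dual_def standard_space_eq)
  qed
  show "?R \<subseteq> alg_dual r Ps (mon_span S)"
  proof
    fix g assume g: "g \<in> ?R"
    have "eval_sum Ps (g * f) = 0" if "f \<in> mon_span S" for f
    proof -
      have "eval_sum Ps (g * f) = (\<Sum>a\<in>Poly_Mapping.keys f. Poly_Mapping.lookup f a *
          (\<Sum>x\<in>points. peval g x * mon_val a x))"
        unfolding eval_sum_mult peval_def [of f] sum_distrib_left
        by (subst sum.swap) (simp add: mult_ac)
      also have "\<dots> = 0"
        using that g by (intro sum.neutral) (auto simp: mon_span_eq_keys_subset)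
      finally show ?thesis .
    qed
    then show "g \<in> alg_dual r Ps (mon_span S)"
      using g by (simp add: alg_dual_def standard_space_eq)
  qed
qed

lemma subspace_alg_dual: "pvec.subspace (alg_dual r Ps L)"
  using subspace_mon_span [of "standard_mons r (vanishing_ideal (set Ps))"]
  unfolding pvec.subspace_def alg_dual_def
  by (auto simp: eval_sum_mult peval_add peval_pscale distrib_right sum.distrib mult.assoc
      simp flip: sum_distrib_left)

text \<open>
  For weakly divisor-closed \<open>S\<close> the linear system defining the dual involves only the coefficients at
  complements of \<open>S\<close>, and it is unitriangular with respect to the total degree. Conversely, if \<open>b\<close> is a
  weak divisor of some \<open>a \<in> S\<close>, then the complement of \<open>t^b\<close> pairs to \<open>\<plusminus>1\<close> with \<open>t^a\<close> and is not in
  the dual. When the dual contains all monomials outside the complements of \<open>S\<close>, this forces \<open>b \<in> S\<close>.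
\<close>

lemma weakly_divisor_closed_iff_alg_dual:
  assumes "S \<subseteq> box"
  shows "weakly_divisor_closed d S \<longleftrightarrow>
    alg_dual r Ps (mon_span S) = mon_span (box - complement_mon d ` S)"
proof
  assume closed: "weakly_divisor_closed d S"
  show "alg_dual r Ps (mon_span S) = mon_span (box - complement_mon d ` S)"
  proof
    show "mon_span (box - complement_mon d ` S) \<subseteq> alg_dual r Ps (mon_span S)"
    proof
      fix g :: "('s, 'k) mpol"
      assume "g \<in> mon_span (box - complement_mon d ` S)"
      then have keys: "Poly_Mapping.keys g \<subseteq> box - complement_mon d ` S"
        by (simp add: mon_span_eq_keys_subset)
      then have box: "Poly_Mapping.keys g \<subseteq> box"
        by auto
      have "(\<Sum>x\<in>points. peval g x * mon_val a x) = 0" if "a \<in> S" for a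
      proof -
        have "Poly_Mapping.lookup g (complement_mon d b) = 0" if "weak_divisor d b a" for b
          using that \<open>a \<in> S\<close> closed keys unfolding weakly_divisor_closed_iff
          by (auto simp: subset_iff in_keys_iff)
        then show ?thesis
          using that assms by (subst pairing_poly_mon [OF box]) auto
      qed
      then show "g \<in> alg_dual r Ps (mon_span S)"
        using box by (simp add: alg_dual_mon_span)
    qed
    show "alg_dual r Ps (mon_span S) \<subseteq> mon_span (box - complement_mon d ` S)"
    proof
      fix g assume "g \<in> alg_dual r Ps (mon_span S)"
      then have box: "Poly_Mapping.keys g \<subseteq> box"
        and zero: "\<And>a. a \<in> S \<Longrightarrow> (\<Sum>x\<in>points. peval g x * mon_val a x) = 0"
        by (auto simp: alg_dual_mon_span)
      have "Poly_Mapping.lookup g (complement_mon d a) = 0" if "a \<in> S" for a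
        using that
      proof (induction "total_deg a" arbitrary: a rule: less_induct)
        case less
        have a: "a \<in> box"
          using less.prems assms by auto
        have fin: "finite {b. weak_divisor d b a}"
          by (rule finite_subset [OF _ finite_box]) (auto intro: weak_divisor_in_box [OF a])
        have "0 = (\<Sum>b | weak_divisor d b a. Poly_Mapping.lookup g (complement_mon d b))"
          using zero [OF less.prems] unfolding pairing_poly_mon [OF box a] by simp
        also have "\<dots> = (\<Sum>b\<in>{a}. Poly_Mapping.lookup g (complement_mon d b))"
        proof (rule sum.mono_neutral_right [OF fin])
          show "\<forall>b\<in>{b. weak_divisor d b a} - {a}. Poly_Mapping.lookup g (complement_mon d b) = 0"
            using less closed unfolding weakly_divisor_closed_iff
            by (auto intro: total_deg_weak_divisor_less)
        qed (simp add: weak_divisor_refl)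
        finally show ?case
          by simp
      qed
      then show "g \<in> mon_span (box - complement_mon d ` S)"
        using box by (auto simp: mon_span_eq_keys_subset in_keys_iff)
    qed
  qed
next
  assume eq: "alg_dual r Ps (mon_span S) = mon_span (box - complement_mon d ` S)"
  show "weakly_divisor_closed d S"
    unfolding weakly_divisor_closed_iff
  proof (intro ballI allI impI)
    fix a b assume a: "a \<in> S" and wd: "weak_divisor d b a"
    have b: "b \<in> box"
      using a assms wd weak_divisor_in_box by blast
    have "tmon (complement_mon d b) \<notin> alg_dual r Ps (mon_span S)"
    proof
      assume "tmon (complement_mon d b) \<in> alg_dual r Ps (mon_span S)"
      then have "(\<Sum>x\<in>points. mon_val (complement_mon d b) x * mon_val a x) = 0"
        using a by (simp add: alg_dual_mon_span)
      moreover have "a \<in> box"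
        using a assms by blast
      ultimately show False
        using b wd by (simp add: pairing_complement)
    qed
    then have "complement_mon d b \<in> complement_mon d ` S"
      unfolding eq by (auto simp: mon_span_eq_keys_subset complement_in_box)
    then show "b \<in> S"
      using complement_complement b assms by (metis (no_types, lifting) imageE subsetD)
  qed
qed

section \<open>The dual code and its standard function space\<close>

lemma inj_on_eval: "inj_on (\<lambda>f. vec (length Ps) (\<lambda>i. peval f (Ps ! i))) standard_space"
proof (rule inj_onI)
  fix f g :: "('s, 'k) mpol"
  assume fg: "f \<in> standard_space" "g \<in> standard_space"
    and eq: "vec (length Ps) (\<lambda>i. peval f (Ps ! i)) = vec (length Ps) (\<lambda>i. peval g (Ps ! i))"
  have "peval f (Ps ! i) = peval g (Ps ! i)" if "i < length Ps" for i
    using arg_cong [OF eq, of "\<lambda>v. vec_index v i"] that by simp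
  then have "peval f x = peval g x" if "x \<in> points" for x
    using that by (metis in_set_conv_nth set_Ps)
  then show "f = g"
    using fg by (intro poly_eqI_on_points) (auto simp: standard_space_eq)
qed

lemma scalar_prod_eval:
  "vec (length Ps) (\<lambda>i. peval g (Ps ! i)) \<bullet> vec (length Ps) (\<lambda>i. peval f (Ps ! i)) = eval_sum Ps (g * f)"
  by (simp add: scalar_prod_def eval_sum_def peval_mult atLeast0LessThan)

text \<open>
  Every word is the evaluation of a polynomial supported in the box, by interpolation. Under this
  identification the inner product of words is the value of \<open>\<phi>\<close> at the product of polynomials.
\<close>

lemma code_dual_eq_eval_alg_dual:
  "code_dual (length Ps) (eval_code Ps L) = eval_code Ps (alg_dual r Ps L)"
proof
  show "eval_code Ps (alg_dual r Ps L) \<subseteq> code_dual (length Ps) (eval_code Ps L)"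
    by (auto simp: eval_code_def code_dual_def scalar_prod_eval alg_dual_def)
  show "code_dual (length Ps) (eval_code Ps L) \<subseteq> eval_code Ps (alg_dual r Ps L)"
  proof
    fix v assume v: "v \<in> code_dual (length Ps) (eval_code Ps L)"
    \<comment> \<open>a word is indexed by positions, so its value at a point is read at the position of the point\<close>
    obtain g where g: "Poly_Mapping.keys g \<subseteq> box"
      "\<And>x. x \<in> points \<Longrightarrow> peval g x = vec_index v (THE i. i < length Ps \<and> Ps ! i = x)"
      using interpolation [of "\<lambda>x. vec_index v (THE i. i < length Ps \<and> Ps ! i = x)"] by blast
    have "(THE j. j < length Ps \<and> Ps ! j = Ps ! i) = i" if "i < length Ps" for i
      using that distinct_Ps by (auto simp: nth_eq_iff_index_eq)
    moreover have "Ps ! i \<in> points" if "i < length Ps" for i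
      using that set_Ps nth_mem by blast
    ultimately have eval_g: "vec (length Ps) (\<lambda>i. peval g (Ps ! i)) = v"
      using v by (intro eq_vecI) (auto simp: code_dual_def g(2))
    have "eval_sum Ps (g * f) = 0" if "f \<in> L" for f
      using that v unfolding scalar_prod_eval [symmetric] eval_g
      by (auto simp: code_dual_def eval_code_def)
    then have "g \<in> alg_dual r Ps L"
      using g(1) by (simp add: alg_dual_def standard_space_eq)
    then show "v \<in> eval_code Ps (alg_dual r Ps L)"
      unfolding eval_code_def using eval_g by (auto intro: image_eqI [where x = g])
  qed
qed

text \<open>
  Evaluation is injective on the standard space, so \<open>M\<close> itself is the standard function space of its
  code, and the code is a standard monomial code exactly when \<open>M\<close> is spanned by monomials.
\<close>

lemma standard_monomial_code_eval:
  assumes "pvec.subspace M" and "M \<subseteq> standard_space"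
  shows "standard_monomial_code r Ps (eval_code Ps M) \<longleftrightarrow> (\<exists>N. M = mon_span N)"
proof -
  obtain F where F: "F \<subseteq> M" "pvec.independent F" "M \<subseteq> pvec.span F"
    using pvec.basis_exists by metis
  have "pvec.span F = M"
    using F assms(1) pvec.span_minimal by blast
  moreover have "finite F"
    using pvec.independent_span_bound [OF _ F(2), of "tmon ` box"] F(1) assms(2) finite_box
    by (auto simp: standard_space_eq simp flip: mon_span_def mon_span_eq_keys_subset)
  ultimately have code: "is_evaluation_code Ps (eval_code Ps M)"
    unfolding is_evaluation_code_def by blast
  have "standard_function_space r Ps (eval_code Ps M) = M"
    unfolding standard_function_space_def
  proof (rule the_equality)
    show "M' = M" if "pvec.subspace M' \<and> M' \<subseteq> standard_space \<and> eval_code Ps M' = eval_code Ps M" for M'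
      using that assms(2) inj_on_image_eq_iff [OF inj_on_eval] unfolding eval_code_def by blast
  qed (use assms in auto)
  with code show ?thesis
    by (simp add: standard_monomial_code_def)
qed

text \<open>
  Monomials of \<open>N\<close> lie outside the complements of \<open>S\<close>, since \<open>t^a\<close> and its complement pair to
  \<open>\<plusminus>1\<close>. For the reverse inclusion, take a monomial whose complement \<open>c\<close> is not in \<open>S\<close>: the
  polynomial interpolating the dual function of \<open>c\<close> is orthogonal to all of \<open>S\<close>, and its coefficient
  at this monomial is \<open>\<plusminus>1\<close>, so the monomial belongs to \<open>N\<close>.
\<close>

lemma monomial_alg_dual_support:
  assumes "S \<subseteq> box" and dual: "alg_dual r Ps (mon_span S) = mon_span N"
  shows "N = box - complement_mon d ` S"
proof
  show "N \<subseteq> box - complement_mon d ` S"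
  proof
    fix b assume "b \<in> N"
    then have "tmon b \<in> alg_dual r Ps (mon_span S)"
      unfolding dual by (simp add: mon_span_eq_keys_subset)
    then have b: "b \<in> box" and orth: "\<And>a. a \<in> S \<Longrightarrow> (\<Sum>x\<in>points. mon_val b x * mon_val a x) = 0"
      by (auto simp: alg_dual_mon_span)
    moreover have "b \<noteq> complement_mon d a" if "a \<in> S" for a
      using orth [OF that] pairing_complement [of a a] that assms(1)
      by (auto simp: weak_divisor_refl)
    ultimately show "b \<in> box - complement_mon d ` S"
      by auto
  qed
  show "box - complement_mon d ` S \<subseteq> N"
  proof
    fix b assume b: "b \<in> box - complement_mon d ` S"
    define c where "c = complement_mon d b"
    have bc: "b = complement_mon d c"
      using b complement_complement [of b] by (simp add: c_def)
    have c: "c \<in> box"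
      by (simp add: c_def complement_in_box)
    have "c \<notin> S"
      using b bc by blast
    obtain g where g: "Poly_Mapping.keys g \<subseteq> box" "\<And>x. x \<in> points \<Longrightarrow> peval g x = dual_mon c x"
      using interpolation [of "dual_mon c"] by blast
    have "(\<Sum>x\<in>points. peval g x * mon_val a x) = 0" if "a \<in> S" for a
    proof -
      have "(\<Sum>x\<in>points. peval g x * mon_val a x) = (\<Sum>x\<in>points. mon_val a x * dual_mon c x)"
        by (intro sum.cong) (simp_all add: g(2) mult.commute)
      also have "\<dots> = of_bool (a = c)"
        using that assms(1) unfolding dual_mon_orthogonal [OF c]
        by (auto simp: box_def fold_expo_id poly_mapping_eq_iff fun_eq_iff subset_iff)
      finally show ?thesis
        using that \<open>c \<notin> S\<close> by auto
    qed
    then have "g \<in> mon_span N"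
      using g(1) by (simp add: alg_dual_mon_span flip: dual)
    moreover have "Poly_Mapping.lookup g b = (-1) ^ card (UNIV :: 's set)"
      unfolding bc using g(1)
      by (simp add: coefficient_eq_pairing complement_in_box g(2) dual_mon_self_pairing [OF c])
    ultimately show "b \<in> N"
      by (auto simp: mon_span_eq_keys_subset in_keys_iff subset_iff)
  qed
qed

end

section \<open>The equivalences\<close>

theorem theorem7p8:
  fixes A B :: "'s::finite \<Rightarrow> 'k::{field, finite} set"
    and d e :: "'s \<Rightarrow> nat"
    and p :: nat
    and Ps :: "('s \<Rightarrow> 'k) list"
    and X :: "('s \<Rightarrow> 'k) set"
    and I :: "('s, 'k) mpol set"
    and r :: "('s expo \<times> 's expo) set"
    and \<Delta> \<A> \<B> :: "'s expo set"
    and L :: "('s, 'k) mpol set"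
  assumes "p = CHAR('k)"
    and "\<And>j. subgroup (A j) units_group"
    and "\<And>j. B j = A j \<union> {0}"
    and "X = {x. \<forall>j. x j \<in> B j}"
    and "distinct Ps" and "set Ps = X"
    and "I = vanishing_ideal X"
    and "graded_monomial_order r"
    and "\<Delta> = standard_mons r I"
    and "\<And>j. d j = card (A j)" and "\<And>j. e j = card (B j)"
    and "\<And>j. gcd p (e j) = p"
    and "pvec.subspace L"
    and "\<A> \<subseteq> \<Delta>"
    and "pvec.independent (tmon ` \<A> :: ('s, 'k) mpol set)" and "pvec.span (tmon ` \<A>) = L"
    and "\<B> = complement_mon d ` \<A>"
  shows "(weakly_divisor_closed d \<A> \<longleftrightarrow> alg_dual r Ps L = mon_span (\<Delta> - \<B>)) \<and>
         (alg_dual r Ps L = mon_span (\<Delta> - \<B>) \<longleftrightarrow>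
            standard_monomial_code r Ps (code_dual (length Ps) (eval_code Ps L)))"
proof -
  have "subgroup_with_zero (A j) (d j)" for j
  proof (rule subgroup_with_zero.intro)
    show "finite (A j)" and "subgroup (A j) units_group" and "card (A j) = d j"
      using assms(2,10) by auto
    have "0 \<notin> A j"
      using subgroup.subset [OF assms(2) [of j]] by (auto simp: units_group_def)
    then have "e j = d j + 1"
      using assms(3,10,11) by simp
    moreover have "p dvd e j"
      using assms(12) by (metis gcd_dvd2)
    ultimately have "of_nat (d j + 1) = (0 :: 'k)"
      using assms(1) by (simp only: of_nat_eq_0_iff_char_dvd)
    then show "of_nat (d j) = (-1 :: 'k)"
      by (simp add: eq_neg_iff_add_eq_0 add.commute)
  qed
  then interpret subgroup_product A d
    by (rule subgroup_product.intro)
  have X: "X = points"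
    using assms(3,4) by (simp add: points_def)
  interpret evaluation_points A d Ps r
    by (intro evaluation_points.intro evaluation_points_axioms.intro subgroup_product_axioms)
      (use assms X in auto)
  have \<Delta>: "\<Delta> = box"
    unfolding assms(7,9) X using assms(8) by (rule standard_mons_eq_box)
  have L: "L = mon_span \<A>"
    using assms(16) by (simp add: mon_span_def)
  have "alg_dual r Ps L \<subseteq> standard_space"
    by (auto simp: alg_dual_def)
  then have "standard_monomial_code r Ps (code_dual (length Ps) (eval_code Ps L)) \<longleftrightarrow>
      (\<exists>N. alg_dual r Ps L = mon_span N)"
    unfolding code_dual_eq_eval_alg_dual by (intro standard_monomial_code_eval subspace_alg_dual)
  moreover have "(\<exists>N. alg_dual r Ps L = mon_span N) \<longleftrightarrow> alg_dual r Ps L = mon_span (\<Delta> - \<B>)"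
    using monomial_alg_dual_support [of \<A>] assms(14,17) unfolding \<Delta> L by blast
  ultimately show ?thesis
    using weakly_divisor_closed_iff_alg_dual [of \<A>] assms(14,17) unfolding \<Delta> L by blast
qed

end
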